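(* Let $0<a<1$, and let $|\mathcal C_1|$ be the length of the cycle that contains $1$. Under $\mu$, the uniform distribution on $\partial B(I,an)$, as $n\to\infty$, $$|\mathcal C_1|\Rightarrow\mathbf G ,$$ where $\mathbf G$ is a geometric random variable with $P(\mathbf G>k)=\left(\frac{b}{1+b}\right)^k$ for all integers $k\ge0$, and $b>0$ satisfies $\frac{\log(1+b)}{b}=1-a$.
   Context: $\mathcal S_n$ is the set of permutations of $\{1,\dots,n\}$, with $d$ the graph distance in the Cayley graph of $\mathcal S_n$ with respect to the set of all transpositions, $I$ the identity. $\partial B(I,an)=\{\sigma\in\mathcal S_n:d(I,\sigma)=\lfloor an\rfloor\}$. $\Rightarrow$ denotes convergence in distribution. *)

theory Defs
  imports "HOL-Probability.Probability" "HOL-Combinatorics.Orbits" "HOL-Combinatorics.Permutations"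
begin

definition sym_perms :: "nat \<Rightarrow> (nat \<Rightarrow> nat) set" where
  "sym_perms n = {\<sigma>. \<sigma> permutes {1..n}}"

definition transpositions :: "nat \<Rightarrow> (nat \<Rightarrow> nat) set" where
  "transpositions n = {Transposition.transpose i j | i j. i \<in> {1..n} \<and> j \<in> {1..n} \<and> i \<noteq> j}"

text \<open>The edge relation of the Cayley graph. It is symmetric, since transpositions are involutions.\<close>

definition cayley_edges :: "nat \<Rightarrow> ((nat \<Rightarrow> nat) \<times> (nat \<Rightarrow> nat)) set" where
  "cayley_edges n = {(\<sigma>, \<sigma> \<circ> \<tau>) | \<sigma> \<tau>. \<sigma> \<in> sym_perms n \<and> \<tau> \<in> transpositions n}"

text \<open>The distance is the minimal length of a walk. Every permutation is a product of
  transpositions, so the \<open>LEAST\<close> is attained whenever both arguments are in \<open>sym_perms n\<close>.\<close>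

definition cayley_dist :: "nat \<Rightarrow> (nat \<Rightarrow> nat) \<Rightarrow> (nat \<Rightarrow> nat) \<Rightarrow> nat" where
  "cayley_dist n \<sigma> \<rho> = (LEAST k. (\<sigma>, \<rho>) \<in> cayley_edges n ^^ k)"

definition cayley_sphere :: "nat \<Rightarrow> real \<Rightarrow> (nat \<Rightarrow> nat) set" where
  "cayley_sphere n r = {\<sigma> \<in> sym_perms n. int (cayley_dist n id \<sigma>) = \<lfloor>r\<rfloor>}"

text \<open>For a permutation of a finite set, the orbit of \<open>x\<close> is the set of elements of the cycle
  through \<open>x\<close>; a fixed point forms a cycle of length 1.\<close>

definition cycle_length :: "(nat \<Rightarrow> nat) \<Rightarrow> nat \<Rightarrow> nat" where
  "cycle_length \<sigma> x = card (orbit \<sigma> x)"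

end

theory Submission
  imports Defs "HOL-Combinatorics.Stirling" "HOL-Real_Asymp.Real_Asymp"
begin

text \<open>
  Multiplication by a transposition changes the number of cycles by one, so the distance of a
  permutation of \<open>n\<close> points from the identity is \<open>n\<close> minus its number of cycles (\<open>cayley_dist_id\<close>). The
  sphere therefore consists of the permutations with exactly \<open>k = n - \<lfloor>a n\<rfloor>\<close> cycles, and these are counted
  by the Stirling number of the first kind \<open>c(n,k)\<close>.

  Suppose that the cycle of \<open>1\<close> has more than one point, and erase the successor of \<open>1\<close> from it. This
  leaves a permutation of \<open>n - 1\<close> points with as many cycles, in which the cycle of \<open>1\<close> is one shorter;
  the erased point is an arbitrary one of \<open>n - 1\<close> points. Iterating this gives the exact formula
  (\<open>card_permutations_cycles_orbit\<close>)
  \<open>P(|C\<^sub>1| > j) = (n - 1) \<cdots> (n - j) c(n - j, k) / c(n, k)\<close>.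
  It is a product of \<open>j\<close> quotients \<open>m c(m,k) / c(m + 1,k)\<close> with \<open>m\<close> close to \<open>n\<close>, so it suffices that each
  of them tends to \<open>b / (1 + b)\<close>. By the recurrence of the Stirling numbers such a quotient is
  \<open>1 / (1 + \<theta> / m)\<close> with \<open>\<theta> = c(m,k - 1) / c(m,k)\<close>, and the claim becomes \<open>\<theta> / m \<longlonglongrightarrow> 1 / b\<close>
  (\<open>stirling_ratio_limit\<close>).

  This requires no precise asymptotics of Stirling numbers, because they are log-concave in \<open>k\<close>. Give
  permutations of \<open>m\<close> points a weight \<open>\<theta>\<close> per cycle. Log-concavity means that, for the above value of \<open>\<theta>\<close>,
  the most likely number of cycles is \<open>k\<close>; it has probability at least \<open>1 / (m + 1)\<close>. On the other hand,
  the generating function of the number of cycles is the explicit product of the factors \<open>\<theta> + i\<close> over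
  \<open>i < m\<close>, so an exponential moment bound shows that any value with such a probability differs from the
  mean, which is the sum of \<open>\<theta> / (\<theta> + i)\<close>, by only \<open>o(m)\<close> (\<open>mode_near_mean\<close>). Comparing the sum with an
  integral, the mean is \<open>m g(\<theta> / m) + O(1)\<close> with \<open>g(x) = x ln (1 + 1 / x)\<close>. Hence \<open>g(\<theta> / m)\<close> tends to
  \<open>1 - a = ln (1 + b) / b = g(1 / b)\<close>, and as \<open>g\<close> is strictly increasing, \<open>\<theta> / m\<close> tends to \<open>1 / b\<close>.
\<close>

section \<open>Cycles and splicing a point into a cycle\<close>

definition cycles :: "'a set \<Rightarrow> ('a \<Rightarrow> 'a) \<Rightarrow> 'a set set" where
  "cycles S \<sigma> = orbit \<sigma> ` S"

lemma card_cycles_le: "finite S \<Longrightarrow> card (cycles S \<sigma>) \<le> card S"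
  by (simp add: cycles_def card_image_le)

lemma card_cycles_id: "card (cycles S id) = card S"
proof -
  have "orbit id x = {x}" for x :: 'a
    by (simp add: orbit_eq_singleton_iff)
  then show ?thesis
    by (simp add: cycles_def card_image)
qed

lemma finite_permutes_self_in_orbit:
  assumes "finite S" "\<sigma> permutes S"
  shows "y \<in> orbit \<sigma> y"
  by (rule permutation_self_in_orbit) (use assms in \<open>auto simp: permutation_permutes\<close>)

lemma finite_permutes_orbit_eq:
  assumes "finite S" "\<sigma> permutes S" "z \<in> orbit \<sigma> y"
  shows "orbit \<sigma> z = orbit \<sigma> y"
  using orbit_cyclic_eq3[OF cyclic_on_orbit[OF assms(2,1)] assms(3)] .

text \<open>This makes it possible to remove a point at which a permutation rests: the remaining points carry
  the same cycles.\<close>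

lemma card_cycles_fixed_point:
  assumes "finite S" "\<sigma> permutes S" "s \<notin> S"
  shows "card (cycles (insert s S) \<sigma>) = Suc (card (cycles S \<sigma>))"
proof -
  have s: "orbit \<sigma> s = {s}"
    using assms by (simp add: orbit_eq_singleton_iff permutes_not_in)
  have "{s} \<notin> cycles S \<sigma>"
    using assms permutes_orbit_subset[OF assms(2)] by (auto simp: cycles_def)
  then show ?thesis
    using assms(1) by (simp add: cycles_def s)
qed

text \<open>If \<open>\<rho>\<close> fixes \<open>s\<close>, then \<open>\<rho> \<circ> transpose x s\<close> sends \<open>x\<close> to \<open>s\<close>, sends \<open>s\<close> to \<open>\<rho> x\<close>, and is
  otherwise equal to \<open>\<rho>\<close>. It arises by splicing \<open>s\<close> into the cycle of \<open>x\<close>, directly after \<open>x\<close>, so the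
  cycle of \<open>x\<close> grows by one point and no other cycle changes.\<close>

lemma splice_permutes:
  assumes "\<rho> permutes S - {s}" "x \<in> S" "s \<in> S"
  shows "\<rho> \<circ> Transposition.transpose x s permutes S"
  using assms by (intro permutes_compose[OF permutes_swap_id] permutes_subset[OF assms(1)]) auto

lemma orbit_splice:
  assumes "finite S" "\<rho> permutes S - {s}" "x \<in> S" "s \<in> S" "x \<noteq> s" "y \<noteq> s"
  shows "orbit (\<rho> \<circ> Transposition.transpose x s) y - {s} = orbit \<rho> y"
proof -
  define \<sigma> where "\<sigma> = \<rho> \<circ> Transposition.transpose x s"
  have rs: "\<rho> s = s"
    using assms(2) by (simp add: permutes_not_in)
  have ne: "\<rho> z \<noteq> s" if "z \<noteq> s" for z
    using that rs permutes_inj[OF assms(2)] by (metis injD)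
  have \<sigma>x: "\<sigma> x = s" and \<sigma>s: "\<sigma> s = \<rho> x" and \<sigma>: "\<And>z. z \<noteq> x \<Longrightarrow> z \<noteq> s \<Longrightarrow> \<sigma> z = \<rho> z"
    using rs by (auto simp: \<sigma>_def)
  have fwd: "\<rho> z \<in> orbit \<sigma> z \<and> \<rho> z \<noteq> s" if "z \<noteq> s" for z
    using that ne[OF that] \<sigma>x \<sigma>s \<sigma>[of z] orbit.base[of \<sigma> z] orbit.step[OF orbit.base, of \<sigma> z]
    by (cases "z = x") auto
  have "z \<in> orbit \<sigma> y \<and> z \<noteq> s" if "z \<in> orbit \<rho> y" for z
    using that
  proof induction
    case base
    then show ?case
      using fwd assms(6) by blast
  next
    case (step z)
    then show ?case
      using fwd[of z] orbit_trans[of "\<rho> z" \<sigma> z y] by simp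
  qed
  \<comment> \<open>An orbit of the spliced permutation passes from \<open>x\<close> through \<open>s\<close> to \<open>\<rho> x\<close>. While it visits \<open>s\<close>, the
    invariant speaks of the point \<open>\<rho> x\<close> that follows.\<close>
  moreover have "(if z = s then \<rho> x else z) \<in> orbit \<rho> y" if "z \<in> orbit \<sigma> y" for z
    using that
  proof induction
    case base
    then show ?case
      using \<sigma>x \<sigma> ne assms(6) orbit.base[of \<rho> y] by (cases "y = x") auto
  next
    case (step z)
    consider "z = s" | "z = x" | "z \<noteq> s" "z \<noteq> x" by blast
    then show ?case
    proof cases
      case 1
      then show ?thesis using step.IH \<sigma>s ne[OF assms(5)] by simp
    next
      case 2
      then show ?thesis using step.IH \<sigma>x assms(5) orbit.step by fastforce
    next
      case 3
      then show ?thesis using step.IH \<sigma> ne orbit.step[of z \<rho> y] by simp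
    qed
  qed
  ultimately show ?thesis
    unfolding \<sigma>_def[symmetric] by (fastforce split: if_splits)
qed

lemma splice_in_orbit:
  assumes "\<rho> permutes S - {s}"
  shows "s \<in> orbit (\<rho> \<circ> Transposition.transpose x s) x"
  using assms by (auto intro: orbit_eqI(1) simp: permutes_not_in)

lemma card_orbit_splice:
  assumes "finite S" "\<rho> permutes S - {s}" "x \<in> S" "s \<in> S" "x \<noteq> s"
  shows "card (orbit (\<rho> \<circ> Transposition.transpose x s) x) = Suc (card (orbit \<rho> x))"
proof -
  have "orbit (\<rho> \<circ> Transposition.transpose x s) x = insert s (orbit \<rho> x)" "s \<notin> orbit \<rho> x"
    using orbit_splice[OF assms assms(5)] splice_in_orbit[OF assms(2), of x] by auto
  moreover have "finite (orbit \<rho> x)"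
    using finite_orbit[OF finite_permutes_self_in_orbit[OF _ assms(2)]] assms(1) by simp
  ultimately show ?thesis
    by simp
qed

lemma card_cycles_splice:
  assumes "finite S" "\<rho> permutes S - {s}" "x \<in> S" "s \<in> S" "x \<noteq> s"
  shows "card (cycles S (\<rho> \<circ> Transposition.transpose x s)) = card (cycles (S - {s}) \<rho>)"
proof -
  let ?\<sigma> = "\<rho> \<circ> Transposition.transpose x s"
  have \<sigma>: "?\<sigma> permutes S"
    using splice_permutes[OF assms(2-4)] .
  have same: "orbit ?\<sigma> s = orbit ?\<sigma> x"
    using finite_permutes_orbit_eq[OF assms(1) \<sigma> splice_in_orbit[OF assms(2)]] .
  have "cycles S ?\<sigma> = orbit ?\<sigma> ` (S - {s})"
    using same assms by (auto simp: cycles_def)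
  then have "card (cycles S ?\<sigma>) = card (orbit ?\<sigma> ` (S - {s}))"
    by (rule arg_cong)
  \<comment> \<open>The point \<open>s\<close> is not alone in its cycle, so cycles remain nonempty, and thus distinct, without it.\<close>
  also have "\<dots> = card ((\<lambda>C. C - {s}) ` orbit ?\<sigma> ` (S - {s}))"
  proof (rule card_image[symmetric], rule inj_onI)
    fix C D
    assume C: "C \<in> orbit ?\<sigma> ` (S - {s})" and D: "D \<in> orbit ?\<sigma> ` (S - {s})"
      and eq: "C - {s} = D - {s}"
    then obtain y z where y: "C = orbit ?\<sigma> y" "y \<noteq> s" and z: "D = orbit ?\<sigma> z"
      by blast
    have "y \<in> D"
      using finite_permutes_self_in_orbit[OF assms(1) \<sigma>, of y] y eq by blast
    then show "C = D"
      using finite_permutes_orbit_eq[OF assms(1) \<sigma>, of y z] y z by simp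
  qed
  also have "(\<lambda>C. C - {s}) ` orbit ?\<sigma> ` (S - {s}) = cycles (S - {s}) \<rho>"
    unfolding cycles_def image_image
    by (intro image_cong refl orbit_splice) (use assms in auto)
  finally show ?thesis .
qed

text \<open>Conversely, every permutation that moves \<open>x\<close> comes from splicing in the point \<open>s = \<sigma> x\<close>, in a unique
  way.\<close>

lemma unsplice_permutes:
  assumes "\<sigma> permutes S" "x \<in> S"
  shows "\<sigma> \<circ> Transposition.transpose x (\<sigma> x) permutes S - {\<sigma> x}"
proof (rule permutes_superset)
  show "\<sigma> \<circ> Transposition.transpose x (\<sigma> x) permutes S"
    using assms by (intro permutes_compose[OF permutes_swap_id]) (auto simp: permutes_in_image)
qed auto

lemma splice_unsplice: "(\<sigma> \<circ> Transposition.transpose x s) \<circ> Transposition.transpose x s = \<sigma>"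
  by (simp add: o_assoc[symmetric])

lemma bij_betw_splice:
  assumes "x \<in> S"
  shows "bij_betw (\<lambda>(s, \<rho>). \<rho> \<circ> Transposition.transpose x s) (SIGMA s:S - {x}. {\<rho>. \<rho> permutes S - {s}})
    {\<sigma>. \<sigma> permutes S \<and> \<sigma> x \<noteq> x}"
proof (rule bij_betw_byWitness[where f' = "\<lambda>\<sigma>. (\<sigma> x, \<sigma> \<circ> Transposition.transpose x (\<sigma> x))"])
  show "\<forall>p \<in> SIGMA s:S - {x}. {\<rho>. \<rho> permutes S - {s}}.
      (\<lambda>\<sigma>. (\<sigma> x, \<sigma> \<circ> Transposition.transpose x (\<sigma> x)))
        ((\<lambda>(s, \<rho>). \<rho> \<circ> Transposition.transpose x s) p) = p"
    by (auto simp: permutes_not_in splice_unsplice)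
  show "(\<lambda>(s, \<rho>). \<rho> \<circ> Transposition.transpose x s) ` (SIGMA s:S - {x}. {\<rho>. \<rho> permutes S - {s}})
      \<subseteq> {\<sigma>. \<sigma> permutes S \<and> \<sigma> x \<noteq> x}"
    using assms by (auto intro: splice_permutes simp: permutes_not_in)
  show "(\<lambda>\<sigma>. (\<sigma> x, \<sigma> \<circ> Transposition.transpose x (\<sigma> x))) ` {\<sigma>. \<sigma> permutes S \<and> \<sigma> x \<noteq> x}
      \<subseteq> (SIGMA s:S - {x}. {\<rho>. \<rho> permutes S - {s}})"
    using assms unsplice_permutes by (fastforce simp: permutes_in_image)
qed (simp add: splice_unsplice)

section \<open>Counting permutations by number of cycles\<close>

text \<open>The recursion behind both counts below: a property of permutations that move \<open>x\<close> is counted by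
  summing over the possible images \<open>s\<close> of \<open>x\<close> after erasing \<open>s\<close>.\<close>

lemma card_moving_permutations:
  assumes "finite S" "x \<in> S"
  shows "card {\<sigma>. \<sigma> permutes S \<and> \<sigma> x \<noteq> x \<and> P \<sigma>} =
    (\<Sum>s\<in>S - {x}. card {\<rho>. \<rho> permutes S - {s} \<and> P (\<rho> \<circ> Transposition.transpose x s)})"
proof -
  let ?f = "\<lambda>(s, \<rho>). \<rho> \<circ> Transposition.transpose x s"
  let ?A = "SIGMA s:S - {x}. {\<rho>. \<rho> permutes S - {s} \<and> P (\<rho> \<circ> Transposition.transpose x s)}"
  have "bij_betw ?f ?A {\<sigma>. \<sigma> permutes S \<and> \<sigma> x \<noteq> x \<and> P \<sigma>}"
    unfolding bij_betw_def
  proof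
    show "inj_on ?f ?A"
      by (rule inj_on_subset[OF bij_betw_imp_inj_on[OF bij_betw_splice[OF assms(2)]]]) auto
    have "{\<sigma>. \<sigma> permutes S \<and> \<sigma> x \<noteq> x \<and> P \<sigma>} = {\<sigma> \<in> ?f ` (SIGMA s:S - {x}. {\<rho>. \<rho> permutes S - {s}}). P \<sigma>}"
      unfolding bij_betw_imp_surj_on[OF bij_betw_splice[OF assms(2)]] by auto
    then show "?f ` ?A = {\<sigma>. \<sigma> permutes S \<and> \<sigma> x \<noteq> x \<and> P \<sigma>}"
      by auto
  qed
  then have "card {\<sigma>. \<sigma> permutes S \<and> \<sigma> x \<noteq> x \<and> P \<sigma>} = card ?A"
    by (simp add: bij_betw_same_card)
  also have "\<dots> = (\<Sum>s\<in>S - {x}. card {\<rho>. \<rho> permutes S - {s} \<and> P (\<rho> \<circ> Transposition.transpose x s)})"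
    using assms by (intro card_SigmaI) (auto intro: finite_subset[OF _ finite_permutations])
  finally show ?thesis .
qed

text \<open>Erase \<open>x\<close> if it is fixed, and otherwise erase its image: these two cases are the two summands in
  the recurrence of the Stirling numbers of the first kind.\<close>

theorem card_permutations_cycles:
  assumes "finite S"
  shows "card {\<sigma>. \<sigma> permutes S \<and> card (cycles S \<sigma>) = k} = stirling (card S) k"
  using assms
proof (induction "card S" arbitrary: S k)
  case 0
  then have "{\<sigma>. \<sigma> permutes S \<and> card (cycles S \<sigma>) = k} = (if k = 0 then {id} else {})"
    by (auto simp: cycles_def)
  then show ?case
    using 0 by (cases k) auto
next
  case (Suc n)
  then obtain x where x: "x \<in> S"
    by fastforce
  then have card_diff: "card (S - {s}) = n" if "s \<in> S" for s
    using Suc that by simp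
  have "{\<sigma>. \<sigma> permutes S \<and> card (cycles S \<sigma>) = k} =
      {\<sigma>. \<sigma> permutes S \<and> \<sigma> x = x \<and> card (cycles S \<sigma>) = k} \<union>
      {\<sigma>. \<sigma> permutes S \<and> \<sigma> x \<noteq> x \<and> card (cycles S \<sigma>) = k}"
    by auto
  then have split: "card {\<sigma>. \<sigma> permutes S \<and> card (cycles S \<sigma>) = k} =
      card {\<sigma>. \<sigma> permutes S \<and> \<sigma> x = x \<and> card (cycles S \<sigma>) = k} +
      card {\<sigma>. \<sigma> permutes S \<and> \<sigma> x \<noteq> x \<and> card (cycles S \<sigma>) = k}"
    using Suc.prems
    by (simp add: card_Un_disjoint disjoint_iff finite_subset[OF _ finite_permutations[of S]] Collect_mono)
  have fixing: "\<sigma> permutes S \<and> \<sigma> x = x \<longleftrightarrow> \<sigma> permutes S - {x}" for \<sigma>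
    using x by (auto simp: permutes_not_in intro: permutes_superset permutes_subset)
  have "{\<sigma>. \<sigma> permutes S \<and> \<sigma> x = x \<and> card (cycles S \<sigma>) = k} =
      {\<sigma>. \<sigma> permutes S - {x} \<and> Suc (card (cycles (S - {x}) \<sigma>)) = k}"
    using x Suc.prems card_cycles_fixed_point[of "S - {x}" _ x]
    unfolding conj_assoc[symmetric] fixing
    by (intro Collect_cong conj_cong refl) (simp add: insert_absorb)
  then have fixed: "card {\<sigma>. \<sigma> permutes S \<and> \<sigma> x = x \<and> card (cycles S \<sigma>) = k} =
      (case k of 0 \<Rightarrow> 0 | Suc l \<Rightarrow> stirling n l)"
    using Suc.hyps(1)[of "S - {x}"] card_diff x Suc.prems by (simp split: nat.split)
  have "card {\<sigma>. \<sigma> permutes S \<and> \<sigma> x \<noteq> x \<and> card (cycles S \<sigma>) = k} =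
      (\<Sum>s\<in>S - {x}. card {\<rho>. \<rho> permutes S - {s} \<and> card (cycles (S - {s}) \<rho>) = k})"
    unfolding card_moving_permutations[OF Suc.prems x]
    by (intro sum.cong refl arg_cong[where f = card] Collect_cong)
      (use Suc.prems x card_cycles_splice[of S] in auto)
  also have "\<dots> = (\<Sum>s\<in>S - {x}. stirling n k)"
    using Suc.hyps(1) card_diff Suc.prems by (intro sum.cong refl) auto
  also have "\<dots> = n * stirling n k"
    using card_diff x by simp
  finally show ?case
    unfolding split fixed Suc.hyps(2)[symmetric] by (cases k; cases n) auto
qed

text \<open>If the cycle of \<open>x\<close> has more than \<open>j + 1\<close> points, erasing the image of \<open>x\<close> leaves a cycle with more
  than \<open>j\<close> points and the same number of cycles; the erased point can be any of the points other
  than \<open>x\<close>. After \<open>j\<close> steps the condition on the cycle of \<open>x\<close> is void. If \<open>j \<ge> card S\<close>, the product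
  contains the factor \<open>0\<close>, as it should.\<close>

theorem card_permutations_cycles_orbit:
  assumes "finite S" "x \<in> S"
  shows "card {\<sigma>. \<sigma> permutes S \<and> card (cycles S \<sigma>) = k \<and> card (orbit \<sigma> x) > j} =
    (\<Prod>i=1..j. card S - i) * stirling (card S - j) k"
  using assms
proof (induction j arbitrary: S)
  case 0
  have "orbit \<sigma> x \<noteq> {} \<and> finite (orbit \<sigma> x)" if "\<sigma> permutes S" for \<sigma>
    using finite_orbit[OF finite_permutes_self_in_orbit[OF 0(1) that]] orbit_nonempty[of \<sigma> x] by simp
  then have "{\<sigma>. \<sigma> permutes S \<and> card (cycles S \<sigma>) = k \<and> card (orbit \<sigma> x) > 0} =
    {\<sigma>. \<sigma> permutes S \<and> card (cycles S \<sigma>) = k}"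
    by (auto simp: card_gt_0_iff)
  then show ?case
    using card_permutations_cycles[OF 0(1)] by simp
next
  case (Suc j)
  have "orbit \<sigma> x = {x}" if "\<sigma> x = x" for \<sigma>
    using that by (simp add: orbit_eq_singleton_iff)
  then have "{\<sigma>. \<sigma> permutes S \<and> card (cycles S \<sigma>) = k \<and> card (orbit \<sigma> x) > Suc j} =
    {\<sigma>. \<sigma> permutes S \<and> \<sigma> x \<noteq> x \<and> card (cycles S \<sigma>) = k \<and> card (orbit \<sigma> x) > Suc j}"
    by force
  then have "card {\<sigma>. \<sigma> permutes S \<and> card (cycles S \<sigma>) = k \<and> card (orbit \<sigma> x) > Suc j} =
    card {\<sigma>. \<sigma> permutes S \<and> \<sigma> x \<noteq> x \<and> card (cycles S \<sigma>) = k \<and> card (orbit \<sigma> x) > Suc j}"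
    by (rule arg_cong)
  also have "\<dots> = (\<Sum>s\<in>S - {x}. card {\<rho>. \<rho> permutes S - {s} \<and>
      card (cycles (S - {s}) \<rho>) = k \<and> card (orbit \<rho> x) > j})"
    unfolding card_moving_permutations[OF Suc.prems]
    by (intro sum.cong refl arg_cong[where f = card] Collect_cong)
      (use Suc.prems card_cycles_splice[of S] card_orbit_splice[of S] in auto)
  also have "\<dots> = (\<Sum>s\<in>S - {x}. (\<Prod>i=1..j. card S - 1 - i) * stirling (card S - 1 - j) k)"
    by (intro sum.cong refl, subst Suc.IH) (use Suc.prems in auto)
  also have "\<dots> = (card S - 1) * (\<Prod>i=1..j. card S - Suc i) * stirling (card S - Suc j) k"
    using Suc.prems by simp
  also have "(card S - 1) * (\<Prod>i=1..j. card S - Suc i) = (\<Prod>i=1..Suc j. card S - i)"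
    by (induction j) (simp_all add: mult.assoc[symmetric])
  finally show ?case .
qed

section \<open>Distance in the Cayley graph\<close>

text \<open>A labelling of the points that \<open>\<sigma>\<close> preserves is constant on cycles, so it uses at most one label per
  cycle.\<close>

lemma cycles_label_bound:
  assumes "finite S" "\<sigma> permutes S" "\<And>y. f (\<sigma> y) = f y"
  shows "card (f ` S) \<le> card (cycles S \<sigma>)"
proof -
  have const: "f z = f y" if "z \<in> orbit \<sigma> y" for y z
    using that by induction (simp_all add: assms(3))
  have "f ` S = (\<lambda>C. f (SOME z. z \<in> C)) ` cycles S \<sigma>"
    unfolding cycles_def image_image
    by (intro image_cong refl const[symmetric] someI_ex[of "\<lambda>z. z \<in> orbit \<sigma> y" for y])
      (blast intro: orbit.base)
  then show ?thesis
    using assms(1) by (simp add: card_image_le cycles_def)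
qed

text \<open>Take the cycle of a point under \<open>\<sigma>\<close> as its label and give the cycles of \<open>i\<close> and \<open>j\<close> the same label.
  The transposition preserves this labelling too, and only one label was lost.\<close>

lemma card_cycles_comp_transpose:
  assumes "finite S" "\<sigma> permutes S" "i \<in> S" "j \<in> S"
  shows "card (cycles S \<sigma>) \<le> Suc (card (cycles S (\<sigma> \<circ> Transposition.transpose i j)))"
proof -
  let ?\<tau> = "Transposition.transpose i j"
  define f where "f y = (if orbit \<sigma> y = orbit \<sigma> j then orbit \<sigma> i else orbit \<sigma> y)" for y
  have "orbit \<sigma> (\<sigma> y) = orbit \<sigma> y" for y
    using finite_permutes_orbit_eq[OF assms(1,2) orbit.base] .
  then have \<sigma>: "f (\<sigma> y) = f y" for y
    by (simp add: f_def)
  have "f (?\<tau> y) = f y" for y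
    by (cases "y = i"; cases "y = j") (auto simp: f_def)
  then have "card (f ` S) \<le> card (cycles S (\<sigma> \<circ> ?\<tau>))"
    using assms by (intro cycles_label_bound permutes_compose[OF permutes_swap_id]) (auto simp: \<sigma>)
  moreover have "cycles S \<sigma> \<subseteq> insert (orbit \<sigma> j) (f ` S)"
    by (auto simp: cycles_def f_def)
  then have "card (cycles S \<sigma>) \<le> card (insert (orbit \<sigma> j) (f ` S))"
    using assms(1) by (intro card_mono) auto
  moreover have "card (insert (orbit \<sigma> j) (f ` S)) \<le> Suc (card (f ` S))"
    by (rule card_insert_le_m1) auto
  ultimately show ?thesis
    by linarith
qed

lemma cayley_walk_card_cycles:
  assumes "(id, \<sigma>) \<in> cayley_edges n ^^ k"
  shows "\<sigma> permutes {1..n} \<and> n \<le> card (cycles {1..n} \<sigma>) + k"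
  using assms
proof (induction k arbitrary: \<sigma>)
  case 0
  then have "\<sigma> = id"
    by auto
  then show ?case
    by (simp only: permutes_id card_cycles_id) simp
next
  case (Suc k)
  then obtain \<rho> where \<rho>: "(id, \<rho>) \<in> cayley_edges n ^^ k" and edge: "(\<rho>, \<sigma>) \<in> cayley_edges n"
    by (elim relpow_Suc_E)
  from edge obtain i j where
    \<sigma>: "\<sigma> = \<rho> \<circ> Transposition.transpose i j" and ij: "i \<in> {1..n}" "j \<in> {1..n}"
    unfolding cayley_edges_def transpositions_def by blast
  have IH: "\<rho> permutes {1..n}" "n \<le> card (cycles {1..n} \<rho>) + k"
    using Suc.IH[OF \<rho>] by auto
  have "\<sigma> permutes {1..n}"
    unfolding \<sigma> by (rule permutes_compose[OF permutes_swap_id[OF ij] IH(1)])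
  moreover have "n \<le> card (cycles {1..n} \<sigma>) + Suc k"
    using IH(2) card_cycles_comp_transpose[OF finite_atLeastAtMost IH(1) ij] unfolding \<sigma> by linarith
  ultimately show ?case ..
qed

text \<open>Splitting a point off its cycle by one transposition creates one more cycle, and it makes the point
  a fixed point. Repeating this leads to the identity.\<close>

lemma cayley_walk_exists:
  assumes "\<sigma> permutes {1..n}" "card (cycles {1..n} \<sigma>) + k = n"
  shows "(id, \<sigma>) \<in> cayley_edges n ^^ k"
  using assms
proof (induction "card {y \<in> {1..n}. \<sigma> y \<noteq> y}" arbitrary: \<sigma> k rule: less_induct)
  case less
  show ?case
  proof (cases "\<sigma> = id")
    case True
    then show ?thesis
      using less.prems by (simp add: card_cycles_id)
  next
    case False
    then obtain x where x: "\<sigma> x \<noteq> x"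
      by (auto simp: fun_eq_iff)
    then have "x \<in> {1..n}"
      using permutes_not_in[OF less.prems(1)] by blast
    then have xS: "x \<in> {1..n}" "\<sigma> x \<in> {1..n}"
      using permutes_in_image[OF less.prems(1)] by blast+
    define \<rho> where "\<rho> = \<sigma> \<circ> Transposition.transpose x (\<sigma> x)"
    have \<rho>: "\<rho> permutes {1..n} - {\<sigma> x}"
      using unsplice_permutes[OF less.prems(1) xS(1)] by (simp add: \<rho>_def)
    have \<sigma>: "\<sigma> = \<rho> \<circ> Transposition.transpose x (\<sigma> x)"
      by (simp add: \<rho>_def splice_unsplice)
    have \<rho>': "\<rho> permutes {1..n}"
      using \<rho> by (rule permutes_subset) auto
    have "card (cycles {1..n} \<rho>) = Suc (card (cycles ({1..n} - {\<sigma> x}) \<rho>))"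
      using card_cycles_fixed_point[OF _ \<rho>, of "\<sigma> x"] xS(2) by (simp add: insert_absorb)
    also have "card (cycles ({1..n} - {\<sigma> x}) \<rho>) = card (cycles {1..n} \<sigma>)"
      using card_cycles_splice[OF finite_atLeastAtMost \<rho> xS x[symmetric]] unfolding \<sigma>[symmetric] by (rule sym)
    finally have more: "card (cycles {1..n} \<rho>) = Suc (card (cycles {1..n} \<sigma>))" .
    then obtain l where k: "k = Suc l"
      using less.prems(2) card_cycles_le[of "{1..n}" \<rho>] by (cases k) auto
    have "{y \<in> {1..n}. \<rho> y \<noteq> y} \<subset> {y \<in> {1..n}. \<sigma> y \<noteq> y}"
    proof
      have "\<sigma> (\<sigma> x) \<noteq> \<sigma> x"
        using x permutes_inj[OF less.prems(1)] by (simp add: inj_eq)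
      moreover have "\<rho> (\<sigma> x) = \<sigma> x"
        by (simp add: \<rho>_def)
      ultimately show "{y \<in> {1..n}. \<rho> y \<noteq> y} \<subseteq> {y \<in> {1..n}. \<sigma> y \<noteq> y}"
        "{y \<in> {1..n}. \<rho> y \<noteq> y} \<noteq> {y \<in> {1..n}. \<sigma> y \<noteq> y}"
        using x xS by (auto simp: \<rho>_def Transposition.transpose_def)
    qed
    then have "card {y \<in> {1..n}. \<rho> y \<noteq> y} < card {y \<in> {1..n}. \<sigma> y \<noteq> y}"
      by (intro psubset_card_mono) auto
    then have "(id, \<rho>) \<in> cayley_edges n ^^ l"
      using less.hyps[OF _ \<rho>'] more less.prems(2) k by simp
    moreover have "(\<rho>, \<sigma>) \<in> cayley_edges n"
    proof -
      have "Transposition.transpose x (\<sigma> x) \<in> transpositions n"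
        using xS x[symmetric] unfolding transpositions_def by blast
      then show ?thesis
        using \<rho>' \<sigma> unfolding cayley_edges_def sym_perms_def by blast
    qed
    ultimately show ?thesis
      unfolding k by (rule relpow_Suc_I)
  qed
qed

text \<open>One transposition changes the number of cycles by at most one, and the identity has \<open>n\<close> cycles. So
  at least \<open>n\<close> minus the number of cycles transpositions are needed, and splitting off points one by
  one needs no more.\<close>

theorem cayley_dist_id:
  assumes "\<sigma> permutes {1..n}"
  shows "cayley_dist n id \<sigma> = n - card (cycles {1..n} \<sigma>)"
  unfolding cayley_dist_def
proof (rule Least_equality)
  show "(id, \<sigma>) \<in> cayley_edges n ^^ (n - card (cycles {1..n} \<sigma>))"
    using assms card_cycles_le[of "{1..n}" \<sigma>] by (intro cayley_walk_exists) auto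
  show "n - card (cycles {1..n} \<sigma>) \<le> k" if "(id, \<sigma>) \<in> cayley_edges n ^^ k" for k
    using cayley_walk_card_cycles[OF that] by linarith
qed

corollary cayley_sphere_eq:
  assumes "m \<le> n" "\<lfloor>r\<rfloor> = int m"
  shows "cayley_sphere n r = {\<sigma>. \<sigma> permutes {1..n} \<and> card (cycles {1..n} \<sigma>) = n - m}"
proof -
  have "int (cayley_dist n id \<sigma>) = \<lfloor>r\<rfloor> \<longleftrightarrow> card (cycles {1..n} \<sigma>) = n - m" if "\<sigma> permutes {1..n}" for \<sigma>
    using assms card_cycles_le[of "{1..n}" \<sigma>] unfolding cayley_dist_id[OF that] by auto
  then show ?thesis
    unfolding cayley_sphere_def sym_perms_def by blast
qed

section \<open>Log-concavity of Stirling numbers\<close>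

text \<open>The case \<open>j = i + 1\<close> is the usual log-concavity of a row. The version for arbitrary pairs \<open>i \<le> j\<close> is
  proved directly, because it passes through the recurrence term by term: of the four products in the
  expansion of either side, one is common, and the other three are compared by induction, the mixed
  one by two applications of the hypothesis.\<close>

lemma stirling_log_concave:
  assumes "i \<le> j"
  shows "stirling n i * stirling n (Suc j) \<le> stirling n (Suc i) * stirling n j"
  using assms
proof (induction n arbitrary: i j)
  case 0
  show ?case
    by (cases j) auto
next
  case (Suc n)
  show ?case
  proof (cases i)
    case 0
    then show ?thesis
      by simp
  next
    case (Suc h)
    then obtain l where l: "j = Suc l" "h \<le> l"
      using \<open>i \<le> j\<close> by (cases j) auto
    let ?c = "stirling n"
    have 1: "n * n * (?c (Suc h) * ?c (Suc (Suc l))) \<le> n * n * (?c (Suc (Suc h)) * ?c (Suc l))"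
      using Suc.IH[of "Suc h" "Suc l"] l by simp
    have "?c h * ?c (Suc (Suc l)) \<le> ?c (Suc (Suc h)) * ?c l"
    proof (cases "h = l")
      case False
      then have "?c h * ?c (Suc (Suc l)) \<le> ?c (Suc h) * ?c (Suc l)"
        using Suc.IH[of h "Suc l"] l by simp
      also have "\<dots> \<le> ?c (Suc (Suc h)) * ?c l"
        using Suc.IH[of "Suc h" l] l False by simp
      finally show ?thesis .
    qed simp
    then have 2: "n * (?c h * ?c (Suc (Suc l))) \<le> n * (?c (Suc (Suc h)) * ?c l)"
      by simp
    have 3: "?c h * ?c (Suc l) \<le> ?c (Suc h) * ?c l"
      using Suc.IH l by simp
    show ?thesis
      using add_mono[OF add_mono[OF 1 2] 3] unfolding Suc l(1)
      by (simp add: algebra_simps)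
  qed
qed

lemma stirling_pos:
  assumes "1 \<le> k" "k \<le> n"
  shows "0 < stirling n k"
  using assms
proof (induction n arbitrary: k)
  case (Suc n)
  then obtain l where l: "k = Suc l"
    by (cases k) auto
  show ?case
  proof (cases "l = 0")
    case True
    then show ?thesis
      using Suc l by (cases "n = 0") auto
  next
    case False
    then show ?thesis
      using Suc l by auto
  qed
qed simp

text \<open>By log-concavity this ratio increases in \<open>k\<close>. It is the weight per cycle for which \<open>k - 1\<close> and \<open>k\<close>
  cycles are equally likely, that is, for which \<open>k\<close> is a most likely number of cycles.\<close>

definition stirling_ratio :: "nat \<Rightarrow> nat \<Rightarrow> real" where
  "stirling_ratio n k = stirling n (k - 1) / stirling n k"

text \<open>With weight \<open>\<theta> = c(n,k-1) / c(n,k)\<close> per cycle, the terms \<open>c(n,j) \<theta>\<^sup>j\<close> increase up to \<open>j = k\<close> and decrease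
  from there on.\<close>

lemma stirling_mode:
  assumes "2 \<le> k" "k \<le> n"
  shows "stirling n j * stirling_ratio n k ^ j \<le> stirling n k * stirling_ratio n k ^ k"
proof -
  define \<theta> where "\<theta> = stirling_ratio n k"
  define p where "p j = stirling n j * \<theta> ^ j" for j
  have pos: "0 < stirling n k" "0 < stirling n (k - 1)"
    using assms by (auto intro!: stirling_pos)
  then have \<theta>: "0 < \<theta>" "\<theta> * stirling n k = stirling n (k - 1)"
    by (auto simp: \<theta>_def stirling_ratio_def)
  have up: "p i \<le> p (Suc i)" if "i < k" for i
  proof -
    have "stirling n i * stirling n k \<le> stirling n (Suc i) * stirling n (k - 1)"
      using stirling_log_concave[of i "k - 1" n] that by simp
    then have "real (stirling n i) * stirling n k \<le> stirling n (Suc i) * stirling n (k - 1)"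
      by (metis of_nat_le_iff of_nat_mult)
    also have "\<dots> = (\<theta> * stirling n (Suc i)) * stirling n k"
      using \<theta>(2) by (simp add: algebra_simps)
    finally have "stirling n i \<le> \<theta> * stirling n (Suc i)"
      using pos by simp
    then show ?thesis
      using mult_right_mono[of _ _ "\<theta> ^ i"] \<theta>(1) by (fastforce simp: p_def algebra_simps)
  qed
  have down: "p (Suc i) \<le> p i" if "k \<le> i" for i
  proof -
    have "stirling n (k - 1) * stirling n (Suc i) \<le> stirling n k * stirling n i"
      using stirling_log_concave[of "k - 1" i n] that assms by simp
    then have "real (stirling n (k - 1)) * stirling n (Suc i) \<le> stirling n k * stirling n i"
      by (metis of_nat_le_iff of_nat_mult)
    then have "stirling n k * (\<theta> * stirling n (Suc i)) \<le> stirling n k * real (stirling n i)"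
      unfolding \<theta>(2)[symmetric] by (simp only: mult_ac of_nat_mult)
    then have "\<theta> * stirling n (Suc i) \<le> stirling n i"
      using pos by simp
    then show ?thesis
      using mult_right_mono[of _ _ "\<theta> ^ i"] \<theta>(1) by (fastforce simp: p_def algebra_simps)
  qed
  have "p j \<le> p k"
  proof (cases "j \<le> k")
    case True
    then show ?thesis
      by (induction rule: inc_induct) (use up in \<open>auto intro: order_trans\<close>)
  next
    case False
    then have "k \<le> j"
      by simp
    then show ?thesis
      by (induction rule: dec_induct) (use down in \<open>auto intro: order_trans\<close>)
  qed
  then show ?thesis
    by (simp add: p_def \<theta>_def)
qed

section \<open>Asymptotics of quotients of Stirling numbers\<close>

text \<open>The expected number of cycles of a random permutation of \<open>n\<close> points whose probability is
  proportional to \<open>\<theta>\<close> to the number of cycles (the Ewens distribution): the number of cycles is then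
  distributed as a sum of independent indicators with probabilities \<open>\<theta> / (\<theta> + i)\<close>.\<close>

definition cycle_mean :: "nat \<Rightarrow> real \<Rightarrow> real" where
  "cycle_mean n \<theta> = (\<Sum>i<n. \<theta> / (\<theta> + real i))"

text \<open>The rising factorial \<open>pochhammer \<theta> n\<close> is the generating function of the row of Stirling numbers, so
  this bounds the moment generating function of the number of cycles, with \<open>t\<close> in place of the
  exponential. Since \<open>t < 1\<close> is allowed, it controls both tails.\<close>

lemma pochhammer_tilt:
  fixes \<theta> t :: real
  assumes "0 < \<theta>" "0 < t"
  shows "pochhammer (t * \<theta>) n \<le> pochhammer \<theta> n * exp ((t - 1) * cycle_mean n \<theta>)"
proof -
  have "t * \<theta> + real i \<le> (\<theta> + real i) * exp ((t - 1) * (\<theta> / (\<theta> + real i)))" for i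
  proof -
    have "t * \<theta> + real i = (\<theta> + real i) * (1 + (t - 1) * (\<theta> / (\<theta> + real i)))"
      using assms by (simp add: field_simps)
    also have "\<dots> \<le> (\<theta> + real i) * exp ((t - 1) * (\<theta> / (\<theta> + real i)))"
      using assms by (intro mult_left_mono exp_ge_add_one_self) auto
    finally show ?thesis .
  qed
  then have "pochhammer (t * \<theta>) n \<le> (\<Prod>i<n. (\<theta> + real i) * exp ((t - 1) * (\<theta> / (\<theta> + real i))))"
    unfolding pochhammer_prod atLeast0LessThan
    using assms by (intro prod_mono) (auto intro!: add_nonneg_nonneg)
  also have "\<dots> = pochhammer \<theta> n * exp ((t - 1) * cycle_mean n \<theta>)"
    by (simp add: pochhammer_prod atLeast0LessThan prod.distrib exp_sum[symmetric] cycle_mean_def sum_distrib_left)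
  finally show ?thesis .
qed

text \<open>A most likely value among \<open>n + 1\<close> values has probability at least \<open>1 / (n + 1)\<close>, whereas the
  exponential moment bound makes it exponentially small unless the value is near the mean. For \<open>t > 1\<close>
  this bounds \<open>k\<close> above by the mean, for \<open>t < 1\<close> below, with a logarithmic error.\<close>

lemma mode_near_mean:
  assumes "2 \<le> k" "k \<le> n" "0 < t"
  shows "k * ln t \<le> ln (n + 1) + (t - 1) * cycle_mean n (stirling_ratio n k)"
proof -
  define \<theta> where "\<theta> = stirling_ratio n k"
  have pos: "0 < stirling n k" "0 < stirling n (k - 1)"
    using assms by (auto intro!: stirling_pos)
  then have \<theta>: "0 < \<theta>"
    by (auto simp: \<theta>_def stirling_ratio_def)
  let ?p = "stirling n k * \<theta> ^ k"
  have p: "0 < ?p"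
    using pos \<theta> by simp
  have "t ^ k * ?p = stirling n k * (t * \<theta>) ^ k"
    by (simp add: power_mult_distrib)
  also have "\<dots> \<le> (\<Sum>j\<le>n. stirling n j * (t * \<theta>) ^ j)"
    using assms \<theta> by (intro member_le_sum) auto
  also have "\<dots> = pochhammer (t * \<theta>) n"
    by (rule stirling_pochhammer)
  also have "\<dots> \<le> pochhammer \<theta> n * exp ((t - 1) * cycle_mean n \<theta>)"
    using pochhammer_tilt \<theta> assms by blast
  also have "pochhammer \<theta> n = (\<Sum>j\<le>n. stirling n j * \<theta> ^ j)"
    by (rule stirling_pochhammer[symmetric])
  also have "\<dots> \<le> (\<Sum>j\<le>n. ?p)"
    using stirling_mode[OF assms(1,2)] unfolding \<theta>_def by (intro sum_mono)
  also have "\<dots> = real (n + 1) * ?p"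
    by simp
  finally have "t ^ k * ?p \<le> (real (n + 1) * exp ((t - 1) * cycle_mean n \<theta>)) * ?p"
    by (simp add: mult_ac)
  then have "t ^ k \<le> real (n + 1) * exp ((t - 1) * cycle_mean n \<theta>)"
    using p mult_le_cancel_right_pos by blast
  then have "ln (t ^ k) \<le> ln (real (n + 1) * exp ((t - 1) * cycle_mean n \<theta>))"
    using assms by (subst ln_le_cancel_iff) auto
  then show ?thesis
    using assms by (simp add: ln_realpow ln_mult \<theta>_def add.commute)
qed

text \<open>The limit of \<open>cycle_mean n (n * x) / n\<close>, namely the integral of \<open>x / (x + u)\<close> over \<open>u\<close> between \<open>0\<close> and
  \<open>1\<close>.\<close>

definition mean_density :: "real \<Rightarrow> real" where
  "mean_density x = x * ln (1 + 1 / x)"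

text \<open>The sum is compared with an integral in telescoping form: a term \<open>1 / u\<close> lies between the increments
  of the logarithm over \<open>[u, u + 1]\<close> and over \<open>[u - 1, u]\<close>. The first term has no interval on its left
  and contributes the error \<open>1\<close>.\<close>

lemma cycle_mean_bounds:
  fixes x :: real
  assumes "0 < x" "0 < n"
  shows "cycle_mean n (n * x) \<ge> n * mean_density x" "cycle_mean n (n * x) \<le> 1 + n * mean_density x"
proof -
  define \<theta> where "\<theta> = n * x"
  have \<theta>: "0 < \<theta>"
    using assms by (simp add: \<theta>_def)
  have step: "ln ((u + 1) / u) \<le> 1 / u \<and> 1 / (u + 1) \<le> ln ((u + 1) / u)" if "0 < u" for u :: real
  proof
    show "ln ((u + 1) / u) \<le> 1 / u"
      using ln_le_minus_one[of "(u + 1) / u"] that by (simp add: field_simps)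
    have "- ln ((u + 1) / u) = ln (u / (u + 1))"
      using that by (simp add: ln_div)
    also have "\<dots> \<le> - (1 / (u + 1))"
      using ln_le_minus_one[of "u / (u + 1)"] that by (simp add: field_simps)
    finally show "1 / (u + 1) \<le> ln ((u + 1) / u)"
      by simp
  qed
  have tele: "(\<Sum>i<m. ln ((\<theta> + real i + 1) / (\<theta> + real i))) = ln ((\<theta> + m) / \<theta>)" for m
  proof (induction m)
    case (Suc m)
    then show ?case
      using \<theta> by (simp add: ln_div add_ac)
  qed (use \<theta> in simp)
  have "(\<theta> + n) / \<theta> = 1 + 1 / x"
    using assms by (simp add: \<theta>_def field_simps)
  then have eq: "\<theta> * ln ((\<theta> + n) / \<theta>) = n * mean_density x"
    by (simp add: \<theta>_def mean_density_def)
  have "\<theta> * ln ((\<theta> + n) / \<theta>) = (\<Sum>i<n. \<theta> * ln ((\<theta> + real i + 1) / (\<theta> + real i)))"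
    by (simp add: tele[symmetric] sum_distrib_left)
  also have "\<dots> \<le> (\<Sum>i<n. \<theta> * (1 / (\<theta> + real i)))"
    using \<theta> by (intro sum_mono mult_left_mono conjunct1[OF step]) (auto intro: add_pos_nonneg)
  finally show "cycle_mean n (n * x) \<ge> n * mean_density x"
    unfolding eq by (simp add: cycle_mean_def \<theta>_def)
  obtain m where m: "n = Suc m"
    using assms by (cases n) auto
  have "cycle_mean n \<theta> = 1 + (\<Sum>i<m. \<theta> * (1 / (\<theta> + real i + 1)))"
    using \<theta> unfolding cycle_mean_def m by (subst sum.lessThan_Suc_shift) (simp add: add_ac)
  also have "\<dots> \<le> 1 + (\<Sum>i<m. \<theta> * ln ((\<theta> + real i + 1) / (\<theta> + real i)))"
    using \<theta> by (intro add_left_mono sum_mono mult_left_mono conjunct2[OF step]) (auto intro: add_pos_nonneg)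
  also have "\<dots> = 1 + \<theta> * ln ((\<theta> + m) / \<theta>)"
    by (simp add: tele[symmetric] sum_distrib_left)
  also have "\<dots> \<le> 1 + \<theta> * ln ((\<theta> + n) / \<theta>)"
    using \<theta> m by (intro add_left_mono mult_left_mono) (auto simp: divide_right_mono intro!: ln_mono)
  finally show "cycle_mean n (n * x) \<le> 1 + n * mean_density x"
    unfolding eq by (simp add: \<theta>_def)
qed

lemma mean_density_strict_mono:
  assumes "0 < x" "x < y"
  shows "mean_density x < mean_density y"
proof (rule DERIV_pos_imp_increasing[OF assms(2)])
  fix z assume z: "x \<le> z" "z \<le> y"
  then have "0 < z"
    using assms(1) by simp
  then have "0 < z / (z + 1)" "z / (z + 1) \<noteq> 1"
    by auto
  then have "ln (z / (z + 1)) < z / (z + 1) - 1"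
    using ln_le_minus_one[of "z / (z + 1)"] ln_eq_minus_one[of "z / (z + 1)"] by linarith
  moreover have "z / (z + 1) - 1 = - (1 / (z + 1))" "1 + 1 / z = inverse (z / (z + 1))"
    using \<open>0 < z\<close> by (simp_all add: divide_simps)
  ultimately have "0 < ln (1 + 1 / z) - 1 / (z + 1)"
    using \<open>0 < z\<close> by (simp only: ln_inverse)
  moreover have nonzero: "z + z * z \<noteq> 0"
    using add_pos_pos[OF \<open>0 < z\<close> mult_pos_pos[OF \<open>0 < z\<close> \<open>0 < z\<close>]] by simp
  have "(mean_density has_real_derivative ln (1 + 1 / z) - 1 / (z + 1)) (at z)"
    unfolding mean_density_def using \<open>0 < z\<close> nonzero
    by (auto intro!: derivative_eq_intros simp: field_simps add_pos_pos)
  ultimately show "\<exists>d. DERIV mean_density z :> d \<and> 0 < d"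
    by blast
qed

text \<open>The ratio is the weight \<open>\<theta>\<close> for which \<open>k\<close> is a most likely number of cycles. Then \<open>k\<close> is close to the
  mean, so \<open>mean_density (\<theta> / n)\<close> tends to \<open>ln (1 + b) / b = mean_density (1 / b)\<close>, and strict
  monotonicity of the density turns this into convergence of \<open>\<theta> / n\<close>.\<close>

lemma stirling_ratio_limit:
  fixes k :: "nat \<Rightarrow> nat" and b :: real
  assumes "0 < b"
    and lim: "(\<lambda>n. real (k n) / real n) \<longlonglongrightarrow> ln (1 + b) / b"
    and k: "eventually (\<lambda>n. k n \<le> n) sequentially"
  shows "(\<lambda>n. stirling_ratio n (k n) / real n) \<longlonglongrightarrow> 1 / b"
proof -
  define \<rho> where "\<rho> = ln (1 + b) / b"
  have \<rho>: "0 < \<rho>" "mean_density (1 / b) = \<rho>"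
    using assms(1) by (simp_all add: \<rho>_def mean_density_def)
  define x where "x n = stirling_ratio n (k n) / real n" for n
  have "filterlim (\<lambda>n. real (k n) / real n * real n) at_top sequentially"
    by (rule filterlim_tendsto_pos_mult_at_top[OF lim \<rho>(1)[unfolded \<rho>_def] filterlim_real_sequentially])
  then have "eventually (\<lambda>n. 2 \<le> real (k n) / real n * real n) sequentially"
    by (simp add: filterlim_at_top)
  then have ev: "eventually (\<lambda>n. 2 \<le> k n \<and> k n \<le> n \<and> 0 < n \<and> 0 < x n) sequentially"
    using k eventually_gt_at_top[of 0]
  proof eventually_elim
    case (elim n)
    then have "0 < stirling n (k n)" "0 < stirling n (k n - 1)"
      by (auto intro!: stirling_pos)
    then show ?case
      using elim by (auto simp: x_def stirling_ratio_def)
  qed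
  \<comment> \<open>Here \<open>n * x n\<close> is the weight per cycle. For fixed \<open>t\<close> this compares the mean with \<open>k n\<close> only up to the
    factor \<open>ln t / (t - 1)\<close>; letting \<open>t\<close> tend to \<open>1\<close> from either side removes it.\<close>
  have main: "eventually (\<lambda>n. real (k n) / real n * ln t \<le> ln (real n + 1) / n + (t - 1) * (cycle_mean n (n * x n) / n)) sequentially"
    if "0 < t" for t
    using ev
  proof eventually_elim
    case (elim n)
    then have "real (k n) * ln t \<le> ln (real n + 1) + (t - 1) * cycle_mean n (n * x n)"
      using mode_near_mean[of "k n" n t] that by (simp add: x_def add_ac)
    then show ?case
      using elim by (simp add: field_simps)
  qed
  have small: "(\<lambda>n. ln (real n + 1) / n) \<longlonglongrightarrow> 0"
    by real_asymp
  have lim': "(\<lambda>n. real (k n) / real n) \<longlonglongrightarrow> \<rho>"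
    using lim by (simp add: \<rho>_def)
  have mean: "(\<lambda>n. cycle_mean n (n * x n) / n) \<longlonglongrightarrow> \<rho>"
  proof (rule order_tendstoI)
    fix c assume "c < \<rho>"
    moreover have "((\<lambda>t. \<rho> * ln t / (t - 1)) \<longlongrightarrow> \<rho>) (at_right 1)"
      by real_asymp
    ultimately have "eventually (\<lambda>t. c < \<rho> * ln t / (t - 1)) (at_right 1)"
      by (simp add: order_tendstoD(1))
    then have "eventually (\<lambda>t. c < \<rho> * ln t / (t - 1) \<and> 1 < t) (at_right 1)"
      by (simp add: eventually_at_right_less eventually_conj)
    then obtain t where t: "c < \<rho> * ln t / (t - 1)" "1 < t"
      using eventually_happens'[OF trivial_limit_at_right_real] by blast
    then have t0: "0 < t"
      by simp
    have "(\<lambda>n. (real (k n) / real n * ln t - ln (real n + 1) / n) / (t - 1)) \<longlonglongrightarrow> (\<rho> * ln t - 0) / (t - 1)"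
      using t(2) by (intro tendsto_intros lim' small) auto
    then have "eventually (\<lambda>n. c < (real (k n) / real n * ln t - ln (real n + 1) / n) / (t - 1)) sequentially"
      using t(1) by (simp add: order_tendstoD(1))
    then show "eventually (\<lambda>n. c < cycle_mean n (n * x n) / n) sequentially"
      using main[OF t0]
    proof eventually_elim
      case (elim n)
      then have "(real (k n) / real n * ln t - ln (real n + 1) / n) / (t - 1) \<le> cycle_mean n (n * x n) / n"
        using t(2) by (subst pos_divide_le_eq) (auto simp: algebra_simps)
      then show ?case
        using elim by simp
    qed
  next
    fix c assume "\<rho> < c"
    moreover have "((\<lambda>t. \<rho> * ln t / (t - 1)) \<longlongrightarrow> \<rho>) (at_left 1)"
      by real_asymp
    ultimately have "eventually (\<lambda>t. \<rho> * ln t / (t - 1) < c) (at_left 1)"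
      by (simp add: order_tendstoD(2))
    then have "eventually (\<lambda>t. \<rho> * ln t / (t - 1) < c \<and> 0 < t \<and> t < 1) (at_left 1)"
      using eventually_at_left_real[of 0 1] by (auto elim: eventually_elim2)
    then obtain t where t: "\<rho> * ln t / (t - 1) < c" "0 < t" "t < 1"
      using eventually_happens'[OF trivial_limit_at_left_real] by blast
    have "(\<lambda>n. (real (k n) / real n * ln t - ln (real n + 1) / n) / (t - 1)) \<longlonglongrightarrow> (\<rho> * ln t - 0) / (t - 1)"
      using t by (intro tendsto_intros lim' small) auto
    then have "eventually (\<lambda>n. (real (k n) / real n * ln t - ln (real n + 1) / n) / (t - 1) < c) sequentially"
      using t(1) by (simp add: order_tendstoD(2))
    then show "eventually (\<lambda>n. cycle_mean n (n * x n) / n < c) sequentially"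
      using main[OF t(2)]
    proof eventually_elim
      case (elim n)
      then have "cycle_mean n (n * x n) / n \<le> (real (k n) / real n * ln t - ln (real n + 1) / n) / (t - 1)"
        using t(3) by (subst neg_le_divide_eq) (auto simp: algebra_simps)
      then show ?case
        using elim by simp
    qed
  qed
  have density: "(\<lambda>n. mean_density (x n)) \<longlonglongrightarrow> \<rho>"
  proof (rule tendsto_sandwich)
    show "(\<lambda>n. cycle_mean n (n * x n) / n - 1 / n) \<longlonglongrightarrow> \<rho>"
      using tendsto_diff[OF mean lim_1_over_n] by simp
    show "eventually (\<lambda>n. cycle_mean n (n * x n) / n - 1 / n \<le> mean_density (x n)) sequentially"
      using ev
    proof eventually_elim
      case (elim n)
      then show ?case
        using cycle_mean_bounds(2)[of "x n" n] by (simp add: field_simps)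
    qed
    show "eventually (\<lambda>n. mean_density (x n) \<le> cycle_mean n (n * x n) / n) sequentially"
      using ev
    proof eventually_elim
      case (elim n)
      then show ?case
        using cycle_mean_bounds(1)[of "x n" n] by (simp add: field_simps)
    qed
  qed (rule mean)
  show ?thesis
    unfolding x_def[symmetric]
  proof (rule order_tendstoI)
    fix c assume c: "c < 1 / b"
    show "eventually (\<lambda>n. c < x n) sequentially"
    proof (cases "0 < c")
      case True
      then have "mean_density c < \<rho>"
        using c mean_density_strict_mono \<rho>(2) by metis
      from order_tendstoD(1)[OF density this] ev show ?thesis
      proof eventually_elim
        case (elim n)
        then show ?case
          using mean_density_strict_mono[of "x n" c] by (cases "x n" c rule: linorder_cases) auto
      qed
    next
      case False
      then show ?thesis
        using ev by (auto elim: eventually_mono)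
    qed
  next
    fix c assume c: "1 / b < c"
    have b: "0 < 1 / b"
      using assms(1) by simp
    have "\<rho> < mean_density c"
      using c mean_density_strict_mono[OF b] \<rho>(2) by metis
    from order_tendstoD(2)[OF density this] ev show "eventually (\<lambda>n. x n < c) sequentially"
    proof eventually_elim
      case (elim n)
      then show ?case
        using mean_density_strict_mono[of c "x n"] c b by (cases "x n" c rule: linorder_cases) auto
    qed
  qed
qed

text \<open>By the recurrence for \<open>stirling (Suc n) (k n)\<close> this quotient equals \<open>1 / (1 + \<theta> / n)\<close>, where \<open>\<theta>\<close> is the
  ratio of the preceding lemma. It is the probability that a given point is not fixed by a random
  permutation of \<open>n + 1\<close> points with \<open>k n\<close> cycles.\<close>

lemma stirling_step_limit:
  fixes k :: "nat \<Rightarrow> nat" and b :: real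
  assumes "0 < b"
    and lim: "(\<lambda>n. real (k n) / real n) \<longlonglongrightarrow> ln (1 + b) / b"
    and k: "eventually (\<lambda>n. 1 \<le> k n \<and> k n \<le> n) sequentially"
  shows "(\<lambda>n. real n * stirling n (k n) / stirling (Suc n) (k n)) \<longlonglongrightarrow> b / (1 + b)"
proof -
  have "(\<lambda>n. 1 / (1 + stirling_ratio n (k n) / real n)) \<longlonglongrightarrow> 1 / (1 + 1 / b)"
    using assms(1) by (intro tendsto_intros stirling_ratio_limit[OF assms(1) lim])
      (auto simp: add_pos_pos order_less_imp_not_eq2 intro: eventually_mono[OF k])
  also have "1 / (1 + 1 / b) = b / (1 + b)"
    using assms(1) by (simp add: field_simps)
  finally show ?thesis
  proof (rule Lim_transform_eventually)
    show "eventually (\<lambda>n. 1 / (1 + stirling_ratio n (k n) / real n) =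
        real n * stirling n (k n) / stirling (Suc n) (k n)) sequentially"
      using k
    proof eventually_elim
      case (elim n)
      then obtain l where l: "k n = Suc l"
        by (cases "k n") auto
      have "0 < stirling n (k n)" "0 < n"
        using elim by (auto intro!: stirling_pos)
      then show ?case
        unfolding l by (simp add: stirling_ratio_def field_simps)
    qed
  qed
qed

section \<open>Convergence of the cycle length\<close>

text \<open>The distribution function of an integer-valued variable is determined by the tails at the integers,
  so their convergence gives convergence of the distribution functions at every point, continuity
  point or not.\<close>

lemma weak_conv_m_of_nat:
  fixes M :: "nat \<Rightarrow> 'a measure" and X :: "nat \<Rightarrow> 'a \<Rightarrow> nat" and N :: "'b measure" and Y :: "'b \<Rightarrow> nat"
  assumes "\<And>n. prob_space (M n)" "\<And>n. X n \<in> measurable (M n) (count_space UNIV)"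
    and "prob_space N" "Y \<in> measurable N (count_space UNIV)"
    and tail: "\<And>j. (\<lambda>n. measure (M n) {\<omega> \<in> space (M n). X n \<omega> > j}) \<longlonglongrightarrow> measure N {\<omega> \<in> space N. Y \<omega> > j}"
  shows "weak_conv_m (\<lambda>n. distr (M n) borel (\<lambda>\<omega>. real (X n \<omega>))) (distr N borel (\<lambda>\<omega>. real (Y \<omega>)))"
proof -
  have cdf: "cdf (distr P borel (\<lambda>\<omega>. real (Z \<omega>))) x =
      (if x < 0 then 0 else 1 - measure P {\<omega> \<in> space P. Z \<omega> > nat \<lfloor>x\<rfloor>})"
    if "prob_space P" and Z[measurable]: "Z \<in> measurable P (count_space UNIV)"
    for P :: "'c measure" and Z :: "'c \<Rightarrow> nat" and x
  proof -
    interpret prob_space P by fact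
    have "cdf (distr P borel (\<lambda>\<omega>. real (Z \<omega>))) x = measure P {\<omega> \<in> space P. real (Z \<omega>) \<le> x}"
      by (simp add: cdf_def measure_distr vimage_def Int_def conj_commute)
    also have "\<dots> = (if x < 0 then 0 else 1 - measure P {\<omega> \<in> space P. Z \<omega> > nat \<lfloor>x\<rfloor>})"
    proof (cases "x < 0")
      case True
      then have "{\<omega> \<in> space P. real (Z \<omega>) \<le> x} = {}"
        by auto
      then show ?thesis
        using True by (simp only: measure_empty if_True)
    next
      case False
      have "real m \<le> x \<longleftrightarrow> \<not> nat \<lfloor>x\<rfloor> < m" for m
        using False by (simp add: not_less le_nat_iff le_floor_iff)
      then show ?thesis
        using False prob_neg[of "\<lambda>\<omega>. Z \<omega> > nat \<lfloor>x\<rfloor>"] by simp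
    qed
    finally show ?thesis .
  qed
  show ?thesis
    unfolding weak_conv_m_def weak_conv_def cdf[OF assms(1,2)] cdf[OF assms(3,4)]
    using tail by (simp add: tendsto_diff)
qed

text \<open>The left side is the probability that the cycle of a given point is longer than \<open>j\<close>. It telescopes
  into \<open>j\<close> quotients, each with the limit found above: passing from \<open>n\<close> to \<open>n - j\<close> points with the same
  number of cycles does not affect the limiting proportion of cycles to points.\<close>

lemma stirling_tail_limit:
  fixes k :: "nat \<Rightarrow> nat" and b :: real
  assumes "0 < b"
    and lim: "(\<lambda>n. real (k n) / real n) \<longlonglongrightarrow> ln (1 + b) / b"
    and k: "\<And>m. eventually (\<lambda>n. 1 \<le> k n \<and> k n + m \<le> n) sequentially"
  shows "(\<lambda>n. real ((\<Prod>i=1..j. n - i) * stirling (n - j) (k n)) / real (stirling n (k n)))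
    \<longlonglongrightarrow> (b / (1 + b)) ^ j"
proof (induction j)
  case 0
  have "eventually (\<lambda>n. 1 = real ((\<Prod>i=1..0. n - i) * stirling (n - 0) (k n)) / real (stirling n (k n))) sequentially"
    using k[of 0] by eventually_elim (use stirling_pos in auto)
  then show ?case
    unfolding power_0 by (rule Lim_transform_eventually[OF tendsto_const])
next
  case (Suc j)
  define K where "K m = k (m + Suc j)" for m
  have "(\<lambda>m. real (K m) / real (m + Suc j) * (real (m + Suc j) / real m)) \<longlonglongrightarrow> ln (1 + b) / b * 1"
  proof (rule tendsto_mult)
    show "(\<lambda>m. real (K m) / real (m + Suc j)) \<longlonglongrightarrow> ln (1 + b) / b"
      using LIMSEQ_ignore_initial_segment[OF lim, of "Suc j"] by (simp add: K_def)
    show "(\<lambda>m. real (m + Suc j) / real m) \<longlonglongrightarrow> 1"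
      by real_asymp
  qed
  moreover have "real (K m) / real (m + Suc j) * (real (m + Suc j) / real m) = real (K m) / real m" for m
    by (simp del: of_nat_add of_nat_Suc)
  ultimately have "(\<lambda>m. real (K m) / real m) \<longlonglongrightarrow> ln (1 + b) / b"
    by simp
  moreover have "eventually (\<lambda>m. 1 \<le> K m \<and> K m \<le> m) sequentially"
    using eventually_sequentially_seg[of _ "Suc j", THEN iffD2, OF k[of "Suc j"]]
    by (simp add: K_def)
  ultimately have "(\<lambda>m. real m * stirling m (K m) / stirling (Suc m) (K m)) \<longlonglongrightarrow> b / (1 + b)"
    by (rule stirling_step_limit[OF assms(1)])
  then have shifted: "(\<lambda>n. real (n + Suc j - Suc j) * stirling (n + Suc j - Suc j) (k (n + Suc j)) /
      stirling (Suc (n + Suc j - Suc j)) (k (n + Suc j))) \<longlonglongrightarrow> b / (1 + b)"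
    by (simp only: K_def add_diff_cancel_right')
  have "(\<lambda>n. real (n - Suc j) * stirling (n - Suc j) (k n) / stirling (Suc (n - Suc j)) (k n)) \<longlonglongrightarrow> b / (1 + b)"
    by (rule LIMSEQ_offset[OF shifted])
  from tendsto_mult[OF Suc.IH this]
  have "(\<lambda>n. real ((\<Prod>i=1..j. n - i) * stirling (n - j) (k n)) / real (stirling n (k n)) *
      (real (n - Suc j) * stirling (n - Suc j) (k n) / stirling (Suc (n - Suc j)) (k n)))
      \<longlonglongrightarrow> (b / (1 + b)) ^ Suc j"
    by (simp add: mult.commute)
  then show ?case
  proof (rule Lim_transform_eventually)
    show "eventually (\<lambda>n. real ((\<Prod>i=1..j. n - i) * stirling (n - j) (k n)) / real (stirling n (k n)) *
      (real (n - Suc j) * stirling (n - Suc j) (k n) / stirling (Suc (n - Suc j)) (k n)) =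
      real ((\<Prod>i=1..Suc j. n - i) * stirling (n - Suc j) (k n)) / real (stirling n (k n))) sequentially"
      using k[of "Suc j"]
    proof eventually_elim
      case (elim n)
      then have "Suc (n - Suc j) = n - j" "0 < stirling (n - j) (k n)"
        by (auto intro!: stirling_pos)
      then show ?case
        by simp
    qed
  qed
qed

theorem theorem3:
  fixes a b :: real and M :: "'w measure" and G :: "'w \<Rightarrow> nat"
  assumes "0 < a" "a < 1"
    and "b > 0" "ln (1 + b) / b = 1 - a"
    and "prob_space M" "G \<in> measurable M (count_space UNIV)"
    and "\<And>k. measure M {\<omega> \<in> space M. G \<omega> > k} = (b / (1 + b)) ^ k"
  shows "weak_conv_m
           (\<lambda>n. distr (measure_pmf (pmf_of_set (cayley_sphere n (a * real n)))) borel
                  (\<lambda>\<sigma>. real (cycle_length \<sigma> 1)))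
           (distr M borel (\<lambda>\<omega>. real (G \<omega>)))"
proof (rule weak_conv_m_of_nat)
  define k where "k n = n - nat \<lfloor>a * real n\<rfloor>" for n
  have floor: "nat \<lfloor>a * real n\<rfloor> \<le> n" "\<lfloor>a * real n\<rfloor> = int (nat \<lfloor>a * real n\<rfloor>)" for n
  proof -
    have "a * real n \<le> real n"
      using assms(2) by (intro mult_left_le_one_le) (use assms(1) in auto)
    then show "nat \<lfloor>a * real n\<rfloor> \<le> n"
      by (simp add: nat_le_iff floor_le_iff)
    show "\<lfloor>a * real n\<rfloor> = int (nat \<lfloor>a * real n\<rfloor>)"
      using assms(1) by simp
  qed
  have k: "real (k n) = real n - real_of_int \<lfloor>a * real n\<rfloor>" for n
    using floor(1)[of n] assms(1) by (simp add: k_def)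
  have lim: "(\<lambda>n. real (k n) / real n) \<longlonglongrightarrow> ln (1 + b) / b"
  proof -
    have "(\<lambda>n. (real n - real_of_int \<lfloor>a * real n\<rfloor>) / real n) \<longlonglongrightarrow> 1 - a"
      by real_asymp
    then show ?thesis
      by (simp add: k assms(4))
  qed
  have range: "eventually (\<lambda>n. 1 \<le> k n \<and> k n + m \<le> n) sequentially" for m
  proof -
    have "eventually (\<lambda>n. 1 \<le> real n - real_of_int \<lfloor>a * real n\<rfloor>) sequentially"
      "eventually (\<lambda>n. real m \<le> real_of_int \<lfloor>a * real n\<rfloor>) sequentially"
      using assms(1,2) by real_asymp+
    then show ?thesis
    proof eventually_elim
      case (elim n)
      then have "1 \<le> real (k n)" "real (k n) + real m \<le> real n"
        unfolding k by auto
      then show ?case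
        by linarith
    qed
  qed
  fix j
  have "eventually (\<lambda>n. real ((\<Prod>i=1..j. n - i) * stirling (n - j) (k n)) / real (stirling n (k n)) =
     measure (measure_pmf (pmf_of_set (cayley_sphere n (a * real n))))
       {\<sigma> \<in> space (measure_pmf (pmf_of_set (cayley_sphere n (a * real n)))). cycle_length \<sigma> 1 > j}) sequentially"
    using range[of 0]
  proof eventually_elim
    case (elim n)
    let ?S = "cayley_sphere n (a * real n)"
    have S: "?S = {\<sigma>. \<sigma> permutes {1..n} \<and> card (cycles {1..n} \<sigma>) = k n}"
      unfolding k_def by (rule cayley_sphere_eq[OF floor])
    have card_S: "card ?S = stirling n (k n)"
      unfolding S by (simp add: card_permutations_cycles)
    have "0 < stirling n (k n)"
      using elim by (intro stirling_pos) auto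
    then have "0 < card ?S"
      by (simp only: card_S)
    then have "?S \<noteq> {}" "finite ?S"
      unfolding card_gt_0_iff by blast+
    moreover have "card (?S \<inter> {\<sigma>. cycle_length \<sigma> 1 > j}) = (\<Prod>i=1..j. n - i) * stirling (n - j) (k n)"
      using card_permutations_cycles_orbit[of "{1..n}" 1 "k n" j] elim
      by (simp add: S cycle_length_def Int_def conj_assoc)
    ultimately show ?case
      by (simp add: measure_pmf_of_set card_S)
  qed
  then show "(\<lambda>n. measure (measure_pmf (pmf_of_set (cayley_sphere n (a * real n))))
       {\<sigma> \<in> space (measure_pmf (pmf_of_set (cayley_sphere n (a * real n)))). cycle_length \<sigma> 1 > j})
     \<longlonglongrightarrow> measure M {\<omega> \<in> space M. G \<omega> > j}"
    unfolding assms(7) by (rule Lim_transform_eventually[OF stirling_tail_limit[OF assms(3) lim range]])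
qed (use assms in \<open>auto intro: measure_pmf.prob_space_axioms\<close>)

end
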